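(* Let $f_i:\mathbb{R}\to\mathbb{R}$, $i=1,\dots,n$, be $C^1$ functions such that $f_i'(y)>0$ for all $i$ and all $y\in\mathbb{R}$. Let $C:\mathbb{N}\to\mathbb{R}^{n\times n}$ and consider the time-varying nonlinear system $$x(k+1)=C(k)\begin{bmatrix} f_1(x_1(k))\\ f_2(x_2(k))\\ \vdots\\ f_n(x_n(k))\end{bmatrix},\qquad k\in\mathbb{N}.$$ Suppose that the trajectories of this system evolve on a compact and convex state-space $\Omega\subset\mathbb{R}^n$, and that $C$ is $T$-periodic, i.e. $C(k+T)=C(k)$ for all $k\in\mathbb{N}$, for some integer $T\ge1$. If the linear system $z(k+1)=C(k)z(k)$ is an oscillatory discrete-time system (ODTS) of order $h$, then every solution of the nonlinear system emanating from $\Omega$ converges to an $hT$-periodic solution of the nonlinear system.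
   Context: $\mathbb{N}=\{0,1,2,\dots\}$. A matrix is totally positive (TP) if all its minors (of all orders) are positive, and totally nonnegative (TN) if all its minors are nonnegative. A square matrix $A$ is oscillatory if it is TN and there is an integer $m\ge1$ such that $A^m$ is TP. The linear system $z(k+1)=C(k)z(k)$ is an oscillatory discrete-time system (ODTS) of order $h$ ($h\ge1$ an integer) if $C(k)$ is oscillatory for all $k\in\mathbb{N}$ and every product $C(k_h)\cdots C(k_2)C(k_1)$ with $0\le k_1<k_2<\dots<k_h$ is TP. "The trajectories evolve on $\Omega$" means that $x(k)\in\Omega$ implies $x(k+1)\in\Omega$, for every $k\in\mathbb{N}$. A solution emanating from $\Omega$ is a solution with $x(0)\in\Omega$. A solution $\xi$ is $u$-periodic if $\xi(k+u)=\xi(k)$ for all $k\in\mathbb{N}$ (the minimal period may be smaller). "$x$ converges to a $u$-periodic solution" means that there is a $u$-periodic solution $\xi$ of the system with $x(k)-\xi(k)\to0$ as $k\to\infty$. *)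

theory Defs
  imports "HOL-Analysis.Analysis" "Jordan_Normal_Form.Determinant"
begin

hide_const (open) Matrix.mat Matrix.vec Matrix.row Matrix.rows Matrix.col Matrix.cols
  Determinant.det
hide_type (open) Matrix.mat Matrix.vec
no_notation vec_index (infixl \<open>$\<close> 100)
no_notation scalar_prod (infix \<open>\<bullet>\<close> 70)

text \<open>The index type of vectors and matrices is a finite linear order, i.e. a copy of
  \<open>{1..n}\<close>: the signs of minors depend on the order of rows and columns. The order of a minor
  varies, so its determinant is the one of matrices with dimensions given by natural numbers.\<close>

definition minor ::
  "real ^ 'n::{finite,linorder} ^ 'm::{finite,linorder} \<Rightarrow> 'm set \<Rightarrow> 'n set \<Rightarrow> real" where
  "minor A I J = Determinant.det (Matrix.mat (card I) (card J)
     (\<lambda>(i, j). A $ (sorted_list_of_set I ! i) $ (sorted_list_of_set J ! j)))"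

definition totally_positive ::
  "real ^ 'n::{finite,linorder} ^ 'm::{finite,linorder} \<Rightarrow> bool" where
  "totally_positive A \<longleftrightarrow> (\<forall>I J. I \<noteq> {} \<and> card I = card J \<longrightarrow> minor A I J > 0)"

definition totally_nonnegative ::
  "real ^ 'n::{finite,linorder} ^ 'm::{finite,linorder} \<Rightarrow> bool" where
  "totally_nonnegative A \<longleftrightarrow> (\<forall>I J. I \<noteq> {} \<and> card I = card J \<longrightarrow> minor A I J \<ge> 0)"

text \<open>The operator \<open>^\<close> on \<open>real ^ 'n ^ 'n\<close> is the entrywise power, not the matrix power.\<close>

primrec matrix_power :: "real ^ 'n ^ 'n \<Rightarrow> nat \<Rightarrow> real ^ 'n ^ 'n" where
  "matrix_power A 0 = mat 1"
| "matrix_power A (Suc m) = A ** matrix_power A m"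

definition oscillatory :: "real ^ 'n::{finite,linorder} ^ 'n::{finite,linorder} \<Rightarrow> bool" where
  "oscillatory A \<longleftrightarrow> totally_nonnegative A \<and> (\<exists>m\<ge>1. totally_positive (matrix_power A m))"

text \<open>For \<open>ks = [k\<^sub>1, \<dots>, k\<^sub>h]\<close>, the product \<open>C k\<^sub>h ** \<dots> ** C k\<^sub>1\<close>: later factors on the left.\<close>

definition left_product :: "(nat \<Rightarrow> real ^ 'n ^ 'n) \<Rightarrow> nat list \<Rightarrow> real ^ 'n ^ 'n" where
  "left_product C ks = foldl (\<lambda>P k. C k ** P) (mat 1) ks"

definition ODTS :: "(nat \<Rightarrow> real ^ 'n::{finite,linorder} ^ 'n::{finite,linorder}) \<Rightarrow> nat \<Rightarrow> bool" where
  "ODTS C h \<longleftrightarrow> h \<ge> 1 \<and> (\<forall>k. oscillatory (C k)) \<and>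
     (\<forall>ks. length ks = h \<and> sorted_wrt (<) ks \<longrightarrow> totally_positive (left_product C ks))"

definition is_solution ::
  "(nat \<Rightarrow> real ^ 'n ^ 'n) \<Rightarrow> ('n \<Rightarrow> real \<Rightarrow> real) \<Rightarrow> (nat \<Rightarrow> real ^ 'n) \<Rightarrow> bool" where
  "is_solution C f x \<longleftrightarrow> (\<forall>k. x (k + 1) = C k *v (\<chi> i. f i (x k $ i)))"

definition evolve_on ::
  "(nat \<Rightarrow> real ^ 'n ^ 'n) \<Rightarrow> ('n \<Rightarrow> real \<Rightarrow> real) \<Rightarrow> (real ^ 'n) set \<Rightarrow> bool" where
  "evolve_on C f \<Omega> \<longleftrightarrow> (\<forall>x. is_solution C f x \<longrightarrow> (\<forall>k. x k \<in> \<Omega> \<longrightarrow> x (k + 1) \<in> \<Omega>))"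

definition periodic :: "nat \<Rightarrow> (nat \<Rightarrow> 'a) \<Rightarrow> bool" where
  "periodic u \<xi> \<longleftrightarrow> (\<forall>k. \<xi> (k + u) = \<xi> k)"

definition converges_to_periodic_solution ::
  "(nat \<Rightarrow> real ^ 'n ^ 'n) \<Rightarrow> ('n \<Rightarrow> real \<Rightarrow> real) \<Rightarrow> nat \<Rightarrow> (nat \<Rightarrow> real ^ 'n) \<Rightarrow> bool" where
  "converges_to_periodic_solution C f u x \<longleftrightarrow>
     (\<exists>\<xi>. is_solution C f \<xi> \<and> periodic u \<xi> \<and> (\<lambda>k. x k - \<xi> k) \<longlonglongrightarrow> 0)"

end

theory Submission
  imports Defs
begin

text \<open>The difference \<open>z\<close> of two solutions satisfies \<open>z(k+1) = C(k) D(k) z(k)\<close>, where \<open>D(k)\<close> is the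
  positive diagonal matrix of difference quotients of the \<open>f\<^sub>i\<close>. By Cauchy--Binet, products of \<open>h\<close>
  consecutive matrices \<open>C(k) D(k)\<close> are totally positive, so they diminish the number of sign changes
  and the first coordinate of \<open>z\<close> eventually has a constant nonzero sign along every residue class of
  times modulo \<open>h\<close>. Applied to a solution \<open>x\<close> and its shift by the period \<open>h T\<close>, this makes the
  first coordinate of \<open>x\<close> eventually monotone, hence convergent, along every residue class modulo
  \<open>h T\<close>. Two limit points of \<open>(x(j h T))\<^sub>j\<close> therefore start solutions whose first coordinates agree
  at all times, and applied to those solutions the sign statement forces the limit points to be
  equal.\<close>

section \<open>Minors and the Cauchy--Binet formula\<close>

definition nth_elem :: "'a::linorder set \<Rightarrow> nat \<Rightarrow> 'a" where
  "nth_elem I k = sorted_list_of_set I ! k"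

lemma nth_elem_less:
  assumes "k < l" "l < card I"
  shows "nth_elem I k < nth_elem I l"
  using assms strict_sorted_list_of_set[of I]
  by (simp add: nth_elem_def sorted_wrt_nth_less)

lemma bij_betw_nth_elem:
  assumes "finite I"
  shows "bij_betw (nth_elem I) {0..<card I} I"
  using bij_betw_nth[of "sorted_list_of_set I" "{0..<card I}" I] assms
  by (simp add: nth_elem_def[abs_def] lessThan_atLeast0)

lemma nth_elem_in:
  assumes "finite I" "k < card I"
  shows "nth_elem I k \<in> I"
  using bij_betwE[OF bij_betw_nth_elem[OF assms(1)]] assms(2) by auto

lemma ex_nth_elem:
  assumes "finite I" "i \<in> I"
  obtains k where "k < card I" "i = nth_elem I k"
proof -
  have "i \<in> nth_elem I ` {0..<card I}"
    using bij_betw_nth_elem[OF assms(1)] assms(2) by (simp add: bij_betw_def)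
  then show ?thesis
    using that by auto
qed

text \<open>A finite linearly ordered set has only one increasing enumeration, so
  \<open>nth_elem\<close> is computed by exhibiting any increasing \<open>g\<close> onto
  \<open>I\<close>; the bound \<open>m\<close> is then the cardinality of \<open>I\<close>.\<close>

lemma nth_elem_unique:
  fixes g :: "nat \<Rightarrow> 'a::linorder"
  assumes "\<And>k l. k < l \<Longrightarrow> l < m \<Longrightarrow> g k < g l" "g ` {..<m} = I" "k < m"
  shows "nth_elem I k = g k"
proof -
  let ?xs = "map g [0..<m]"
  have "sorted_wrt (<) ?xs"
    using assms(1) by (simp add: sorted_wrt_iff_nth_less)
  then have "sorted ?xs" "distinct ?xs"
    by (auto simp: strict_sorted_iff)
  then have "sorted_list_of_set (set ?xs) = ?xs"
    by (rule sorted_list_of_set.idem_if_sorted_distinct)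
  moreover have "set ?xs = I"
    using assms(2) by (simp add: lessThan_atLeast0)
  ultimately show ?thesis
    using assms(3) by (simp add: nth_elem_def)
qed

text \<open>Removing position \<open>s\<close> shifts the later positions by one.
  \<open>insert_index\<close> is the shift that \<open>mat_delete\<close> performs, which ties
  deleted matrices to minors of smaller index sets.\<close>

lemma nth_elem_remove:
  assumes "finite I" "s < card I" "k < card I - 1"
  shows "nth_elem (I - {nth_elem I s}) k = nth_elem I (insert_index s k)"
proof (rule nth_elem_unique[where m = "card I - 1"])
  fix k l assume "k < l" "l < card I - 1"
  then show "nth_elem I (insert_index s k) < nth_elem I (insert_index s l)"
    by (intro nth_elem_less) (auto simp: insert_index_def)
next
  have "insert_index s ` {0..<card I - 1} = {0..<card I} - {s}"
    using insert_index_image[of s "card I - 1"] assms(2) by auto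
  then have "(\<lambda>k. nth_elem I (insert_index s k)) ` {..<card I - 1}
      = nth_elem I ` ({0..<card I} - {s})"
    by (simp add: lessThan_atLeast0 flip: image_image)
  also have "\<dots> = I - {nth_elem I s}"
    using bij_betw_nth_elem[OF assms(1)] assms(2)
    unfolding bij_betw_def by (auto simp: inj_on_def)
  finally show "(\<lambda>k. nth_elem I (insert_index s k)) ` {..<card I - 1} = I - {nth_elem I s}" .
qed fact

lemma nth_elem_insert_below:
  assumes "finite I" "\<And>i. i \<in> I \<Longrightarrow> a < i" "k \<le> card I"
  shows "nth_elem (insert a I) k = (if k = 0 then a else nth_elem I (k - 1))"
proof (rule nth_elem_unique[where m = "Suc (card I)"])
  fix k l assume "k < l" "l < Suc (card I)"
  then show "(if k = 0 then a else nth_elem I (k - 1)) < (if l = 0 then a else nth_elem I (l - 1))"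
    using assms nth_elem_in[of I] nth_elem_less[of "k - 1" "l - 1" I] by auto
next
  have "(\<lambda>k. if k = 0 then a else nth_elem I (k - 1)) ` {..<Suc (card I)}
      = insert a (nth_elem I ` {0..<card I})"
    by (simp add: lessThan_Suc_eq_insert_0 image_image del: if_image_distrib flip: lessThan_atLeast0)
  also have "nth_elem I ` {0..<card I} = I"
    using bij_betw_nth_elem[OF assms(1)] by (simp add: bij_betw_def)
  finally show "(\<lambda>k. if k = 0 then a else nth_elem I (k - 1)) ` {..<Suc (card I)} = insert a I" .
qed (use assms in auto)

lemma minor_nth_elem:
  "minor A I J = Determinant.det (Matrix.mat (card I) (card J)
     (\<lambda>(i, j). A $ nth_elem I i $ nth_elem J j))"
  by (simp add: minor_def nth_elem_def)

lemma minor_eq_sum_permutes: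
  assumes "card I = m" "card J = m"
  shows "minor A I J = (\<Sum>p | p permutes {0..<m}.
    signof p * (\<Prod>i = 0..<m. A $ nth_elem I i $ nth_elem J (p i)))"
proof -
  have "(\<Prod>i = 0..<m. (Matrix.mat m m (\<lambda>(i, j). A $ nth_elem I i $ nth_elem J j)) $$ (i, p i))
      = (\<Prod>i = 0..<m. A $ nth_elem I i $ nth_elem J (p i))" if "p permutes {0..<m}" for p
    using permutes_in_image[OF that] by (intro prod.cong) auto
  then show ?thesis
    using assms by (simp add: minor_nth_elem det_def'[of _ m])
qed

lemma minor_rows_permuted:
  fixes B :: "real ^ 'k::{finite,linorder} ^ 'n::{finite,linorder}"
  assumes "card K = m" "card J = m" "p permutes {0..<m}"
  shows "Determinant.det (Matrix.mat m m (\<lambda>(i, j). B $ nth_elem K (p i) $ nth_elem J j))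
    = signof p * minor B K J"
proof -
  let ?B = "Matrix.mat m m (\<lambda>(i, j). B $ nth_elem K i $ nth_elem J j)"
  have "Matrix.mat m m (\<lambda>(i, j). B $ nth_elem K (p i) $ nth_elem J j)
      = Matrix.mat m m (\<lambda>(i, j). ?B $$ (p i, j))"
    using permutes_in_image[OF assms(3)] by (intro eq_matI) auto
  then show ?thesis
    using det_permute_rows[of ?B m p] assms by (simp add: minor_nth_elem)
qed

text \<open>With an enumeration \<open>e\<close> of \<open>K\<close> fixed, an injection of
  \<open>N\<close> onto \<open>K\<close> is \<open>e\<close> after exactly one permutation. The
  restriction makes the map extensional outside \<open>N\<close>; the inverse is the identity there,
  as \<open>permutes\<close> demands.\<close>

lemma bij_betw_permutes_injections_onto:
  assumes "bij_betw e N K"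
  shows "bij_betw (\<lambda>p. restrict (e \<circ> p) N) {p. p permutes N}
    {g \<in> N \<rightarrow>\<^sub>E UNIV. inj_on g N \<and> g ` N = K}"
proof (rule bij_betw_byWitness[where f' = "\<lambda>g i. if i \<in> N then inv_into N e (g i) else i"])
  have inj: "inj_on e N" and img: "e ` N = K"
    using assms by (auto simp: bij_betw_def)
  show "\<forall>p\<in>{p. p permutes N}. (\<lambda>i. if i \<in> N then inv_into N e (restrict (e \<circ> p) N i) else i) = p"
  proof (intro ballI ext)
    fix p i assume "p \<in> {p. p permutes N}"
    then show "(if i \<in> N then inv_into N e (restrict (e \<circ> p) N i) else i) = p i"
      using permutes_in_image[of p N i] permutes_not_in[of p N i] inj by auto
  qed
  show "\<forall>g\<in>{g \<in> N \<rightarrow>\<^sub>E UNIV. inj_on g N \<and> g ` N = K}.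
     restrict (e \<circ> (\<lambda>i. if i \<in> N then inv_into N e (g i) else i)) N = g"
  proof (intro ballI ext)
    fix g i assume "g \<in> {g \<in> N \<rightarrow>\<^sub>E UNIV. inj_on g N \<and> g ` N = K}"
    then have ext: "g \<in> N \<rightarrow>\<^sub>E UNIV" and K: "g ` N = K" by blast+
    show "restrict (e \<circ> (\<lambda>i. if i \<in> N then inv_into N e (g i) else i)) N i = g i"
    proof (cases "i \<in> N")
      case True
      then have "g i \<in> e ` N"
        using K img by blast
      then show ?thesis
        using True by (simp add: f_inv_into_f)
    next
      case False
      then show ?thesis
        using PiE_arb[OF ext False] by simp
    qed
  qed
  show "(\<lambda>p. restrict (e \<circ> p) N) ` {p. p permutes N}
      \<subseteq> {g \<in> N \<rightarrow>\<^sub>E UNIV. inj_on g N \<and> g ` N = K}"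
  proof (rule image_subsetI)
    fix p assume "p \<in> {p. p permutes N}"
    then have p: "p permutes N" by simp
    have "inj_on (e \<circ> p) N"
      using inj permutes_inj_on[OF p] permutes_image[OF p] by (intro comp_inj_on) auto
    moreover have "(e \<circ> p) ` N = K"
      by (metis image_comp img p permutes_image)
    ultimately show "restrict (e \<circ> p) N \<in> {g \<in> N \<rightarrow>\<^sub>E UNIV. inj_on g N \<and> g ` N = K}"
      by (simp add: inj_on_restrict_eq image_restrict_eq)
  qed
  show "(\<lambda>g i. if i \<in> N then inv_into N e (g i) else i) `
      {g \<in> N \<rightarrow>\<^sub>E UNIV. inj_on g N \<and> g ` N = K} \<subseteq> {p. p permutes N}"
  proof (rule image_subsetI)
    fix g assume "g \<in> {g \<in> N \<rightarrow>\<^sub>E UNIV. inj_on g N \<and> g ` N = K}"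
    then have "bij_betw g N K" by (simp add: bij_betw_def)
    then have "bij_betw (inv_into N e \<circ> g) N N"
      using bij_betw_inv_into[OF assms] by (rule bij_betw_trans)
    then have "bij_betw (\<lambda>i. if i \<in> N then inv_into N e (g i) else i) N N"
      by (rule iffD1[OF bij_betw_cong, rotated]) simp
    then show "(\<lambda>i. if i \<in> N then inv_into N e (g i) else i) \<in> {p. p permutes N}"
      using bij_imp_permutes by force
  qed
qed

text \<open>Multilinearity in the rows turns the minor of the product into a sum over all maps
  \<open>g\<close> from row positions to inner indices. Maps that are not injective give a
  determinant with two equal rows; the others are grouped by their image \<open>K\<close>, and
  sorting the rows yields the Leibniz sum for \<open>minor A I K\<close>.\<close>

theorem Cauchy_Binet:
  fixes A :: "real ^ 'n::{finite,linorder} ^ 'm::{finite,linorder}"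
    and B :: "real ^ 'k::{finite,linorder} ^ 'n::{finite,linorder}"
  assumes "card I = card J"
  shows "minor (A ** B) I J = (\<Sum>K | card K = card I. minor A I K * minor B K J)"
proof -
  define m where "m = card I"
  let ?N = "{0..<m}"
  define a where "a i l = A $ nth_elem I i $ l" for i l
  define b where "b l j = B $ l $ nth_elem J j" for l j
  let ?G = "?N \<rightarrow>\<^sub>E (UNIV :: 'n::{finite,linorder} set)"
  let ?D = "\<lambda>g. Determinant.det (Matrix.mat m m (\<lambda>(i, j). b (g i) j))"
  let ?t = "\<lambda>g. (\<Prod>i\<in>?N. a i (g i)) * ?D g"
  let ?H = "\<lambda>K. {g \<in> ?G. inj_on g ?N \<and> g ` ?N = K}"
  have [simp]: "card I = m" "card J = m"
    using assms by (auto simp: m_def)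
  have finG: "finite ?G"
    by (simp add: finite_PiE)
  have D: "?D g = (\<Sum>p | p permutes ?N. signof p * (\<Prod>i\<in>?N. b (g i) (p i)))" for g
  proof -
    have "(\<Prod>i\<in>?N. (Matrix.mat m m (\<lambda>(i, j). b (g i) j)) $$ (i, p i)) = (\<Prod>i\<in>?N. b (g i) (p i))"
      if "p permutes ?N" for p
      using permutes_in_image[OF that] by (intro prod.cong) auto
    then show ?thesis
      by (simp add: det_def'[of _ m])
  qed
  have "minor (A ** B) I J
      = (\<Sum>p | p permutes ?N. signof p * (\<Prod>i\<in>?N. \<Sum>l\<in>UNIV. a i l * b l (p i)))"
    by (simp add: minor_eq_sum_permutes matrix_matrix_mult_def a_def b_def)
  also have "\<dots> = (\<Sum>p | p permutes ?N. \<Sum>g\<in>?G.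
      (\<Prod>i\<in>?N. a i (g i)) * (signof p * (\<Prod>i\<in>?N. b (g i) (p i))))"
    by (simp add: prod_sum_PiE sum_distrib_left prod.distrib mult_ac)
  also have "\<dots> = (\<Sum>g\<in>?G. ?t g)"
    by (subst sum.swap) (simp add: D sum_distrib_left)
  also have "\<dots> = (\<Sum>g\<in>(\<Union>K\<in>{K. card K = m}. ?H K). ?t g)"
  proof (rule sum.mono_neutral_right[OF finG])
    show "\<forall>g\<in>?G - (\<Union>K\<in>{K. card K = m}. ?H K). ?t g = 0"
    proof
      fix g assume g: "g \<in> ?G - (\<Union>K\<in>{K. card K = m}. ?H K)"
      have "\<not> inj_on g ?N"
        using g card_image[of g ?N] by auto
      then obtain i j where ij: "i < m" "j < m" "i \<noteq> j" "g i = g j"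
        unfolding inj_on_def by auto
      have "?D g = 0"
        by (rule det_identical_rows[of _ m i j]) (use ij in \<open>auto intro!: eq_vecI\<close>)
      then show "?t g = 0" by simp
    qed
  qed auto
  also have "\<dots> = (\<Sum>K | card K = m. \<Sum>g\<in>?H K. ?t g)"
    by (rule sum.UNION_disjoint) (use finG in \<open>auto intro: finite_subset\<close>)
  also have "\<dots> = (\<Sum>K | card K = m. minor A I K * minor B K J)"
  proof (rule sum.cong[OF refl])
    fix K :: "'n::{finite,linorder} set" assume "K \<in> {K. card K = m}"
    then have K: "card K = m" by simp
    have "bij_betw (nth_elem K) ?N K"
      using bij_betw_nth_elem[of K] K by simp
    note bij = bij_betw_permutes_injections_onto[OF this]
    have "(\<Sum>g\<in>?H K. ?t g) = (\<Sum>p | p permutes ?N. ?t (restrict (nth_elem K \<circ> p) ?N))"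
      by (rule sum.reindex_bij_betw[OF bij, symmetric])
    also have "\<dots> = (\<Sum>p | p permutes ?N.
        (\<Prod>i\<in>?N. A $ nth_elem I i $ nth_elem K (p i)) * (signof p * minor B K J))"
    proof (rule sum.cong[OF refl])
      fix p assume "p \<in> {p. p permutes ?N}"
      then have p: "p permutes ?N" by simp
      have "Matrix.mat m m (\<lambda>(i, j). b (restrict (nth_elem K \<circ> p) ?N i) j)
          = Matrix.mat m m (\<lambda>(i, j). B $ nth_elem K (p i) $ nth_elem J j)"
        by (rule eq_matI) (auto simp: b_def)
      then show "?t (restrict (nth_elem K \<circ> p) ?N)
          = (\<Prod>i\<in>?N. A $ nth_elem I i $ nth_elem K (p i)) * (signof p * minor B K J)"
        using minor_rows_permuted[OF K _ p, of J B] by (simp add: a_def)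
    qed
    also have "\<dots> = minor A I K * minor B K J"
      by (simp add: minor_eq_sum_permutes[OF _ K] sum_distrib_left mult_ac)
    finally show "(\<Sum>g\<in>?H K. ?t g) = minor A I K * minor B K J" .
  qed
  finally show ?thesis by simp
qed

section \<open>Products of totally nonnegative matrices\<close>

text \<open>In every term of the Leibniz sum the permutation visits each column of \<open>J\<close>
  exactly once, so the scaling factors contribute the same product.\<close>

lemma minor_scale_columns:
  assumes "card I = card J"
  shows "minor (\<chi> i j. A $ i $ j * d j) I J = minor A I J * prod d J"
proof -
  define m where "m = card I"
  have m: "card I = m" "card J = m"
    using assms by (auto simp: m_def)
  have "(\<Prod>i = 0..<m. d (nth_elem J (p i))) = prod d J" if "p permutes {0..<m}" for p
  proof -
    have "bij_betw (nth_elem J \<circ> p) {0..<m} J"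
      using permutes_imp_bij[OF that] bij_betw_nth_elem[of J] m by (auto intro: bij_betw_trans)
    then show ?thesis
      using prod.reindex_bij_betw[of "nth_elem J \<circ> p" "{0..<m}" J d] by simp
  qed
  then show ?thesis
    by (simp add: minor_eq_sum_permutes[OF m] prod.distrib sum_distrib_left mult_ac)
qed

text \<open>Each Cauchy-Binet term is nonnegative. Only minors of \<open>B\<close> on the column set
  \<open>J\<close> are involved, so an induction over products can keep \<open>J\<close>
  fixed.\<close>

lemma minor_product_nonneg:
  fixes A :: "real ^ 'n::{finite,linorder} ^ 'm::{finite,linorder}"
    and B :: "real ^ 'k::{finite,linorder} ^ 'n::{finite,linorder}"
  assumes "totally_nonnegative A" "I \<noteq> {}" "card I = card J"
    and "\<And>K. card K = card I \<Longrightarrow> 0 \<le> minor B K J"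
  shows "0 \<le> minor (A ** B) I J"
  unfolding Cauchy_Binet[OF assms(3)]
proof (intro sum_nonneg mult_nonneg_nonneg)
  fix K :: "'n::{finite,linorder} set" assume "K \<in> {K. card K = card I}"
  then have K: "card K = card I" by simp
  then show "0 \<le> minor A I K"
    using assms(1,2) by (simp add: totally_nonnegative_def)
  show "0 \<le> minor B K J"
    using K by (rule assms(4))
qed

lemma minor_product_pos_iff:
  fixes A :: "real ^ 'n::{finite,linorder} ^ 'm::{finite,linorder}"
    and B :: "real ^ 'k::{finite,linorder} ^ 'n::{finite,linorder}"
  assumes "totally_nonnegative A" "I \<noteq> {}" "card I = card J"
    and "\<And>K. card K = card I \<Longrightarrow> 0 \<le> minor B K J"
  shows "0 < minor (A ** B) I J \<longleftrightarrow> (\<exists>K. card K = card I \<and> 0 < minor A I K \<and> 0 < minor B K J)"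
proof -
  have A: "0 \<le> minor A I K" if "card K = card I" for K
    using assms(1,2) that by (simp add: totally_nonnegative_def)
  have nn: "\<forall>K\<in>{K. card K = card I}. 0 \<le> minor A I K * minor B K J"
    using A assms(4) by simp
  have "0 < minor (A ** B) I J \<longleftrightarrow>
      (\<exists>K\<in>{K. card K = card I}. 0 < minor A I K * minor B K J)"
    unfolding Cauchy_Binet[OF assms(3)]
    using sum_nonneg[of "{K. card K = card I}" "\<lambda>K. minor A I K * minor B K J"]
      sum_nonneg_eq_0_iff[of "{K. card K = card I}" "\<lambda>K. minor A I K * minor B K J"] nn
    by (metis (mono_tags, lifting) finite less_eq_real_def less_irrefl)
  also have "\<dots> \<longleftrightarrow> (\<exists>K. card K = card I \<and> 0 < minor A I K \<and> 0 < minor B K J)"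
    using A assms(4) by (auto simp: zero_less_mult_iff dest!: leD)
  finally show ?thesis .
qed

lemma left_product_single: "left_product C [k] = C k"
  by (simp add: left_product_def)

lemma left_product_snoc: "left_product C (ks @ [k]) = C k ** left_product C ks"
  by (simp add: left_product_def)

text \<open>Positive column scaling keeps the sign of every minor of a single factor. By
  Cauchy-Binet a minor of a product is positive iff some chain of positive minors of the factors
  leads to it, and the same chain survives the scaling.\<close>

lemma minor_left_product_scaled:
  fixes C :: "nat \<Rightarrow> real ^ 'n::{finite,linorder} ^ 'n::{finite,linorder}"
  assumes "\<And>k. totally_nonnegative (C k)" and "\<And>k j. 0 < d k j" and "ks \<noteq> []"
    and "I \<noteq> {}" "card I = card J"
  shows "0 \<le> minor (left_product C ks) I J"
    and "0 \<le> minor (left_product (\<lambda>k. \<chi> i j. C k $ i $ j * d k j) ks) I J"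
    and "0 < minor (left_product C ks) I J \<Longrightarrow>
      0 < minor (left_product (\<lambda>k. \<chi> i j. C k $ i $ j * d k j) ks) I J"
proof -
  let ?D = "\<lambda>k. \<chi> i j. C k $ i $ j * d k j"
  have prod_pos: "0 < prod (d k) J" for k J
    using assms(2) by (simp add: prod_pos)
  have D: "totally_nonnegative (?D k)" for k
    using assms(1)[of k] prod_pos[of k]
    by (auto simp: totally_nonnegative_def minor_scale_columns less_imp_le)
  \<comment> \<open>The three claims are proved together, for arbitrary \<open>I\<close>: the
    positivity criterion in the induction step needs nonnegativity for both shorter products on
    every row set \<open>K\<close>.\<close>
  have "0 \<le> minor (left_product C ks) I J \<and> 0 \<le> minor (left_product ?D ks) I J \<and>
      (0 < minor (left_product C ks) I J \<longrightarrow> 0 < minor (left_product ?D ks) I J)"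
    using assms(3-5)
  proof (induction ks arbitrary: I rule: rev_nonempty_induct)
    case (single k)
    then show ?case
      using assms(1)[of k] prod_pos[of k]
      by (auto simp: totally_nonnegative_def left_product_single minor_scale_columns less_imp_le)
  next
    case (snoc k ks)
    have IH: "0 \<le> minor (left_product C ks) K J" "0 \<le> minor (left_product ?D ks) K J"
      "0 < minor (left_product C ks) K J \<longrightarrow> 0 < minor (left_product ?D ks) K J"
      if "card K = card I" for K
    proof -
      have "K \<noteq> {}" "card K = card J"
        using that snoc.prems by auto
      then show "0 \<le> minor (left_product C ks) K J" "0 \<le> minor (left_product ?D ks) K J"
        "0 < minor (left_product C ks) K J \<longrightarrow> 0 < minor (left_product ?D ks) K J"
        using snoc.IH by blast+
    qed
    have "0 < minor (C k ** left_product C ks) I J \<longrightarrow> 0 < minor (?D k ** left_product ?D ks) I J"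
    proof
      assume "0 < minor (C k ** left_product C ks) I J"
      then obtain K where K: "card K = card I" "0 < minor (C k) I K"
        "0 < minor (left_product C ks) K J"
        using minor_product_pos_iff[OF assms(1) snoc.prems IH(1)] by blast
      then have "0 < minor (?D k) I K"
        using prod_pos[of k] by (simp add: minor_scale_columns)
      then show "0 < minor (?D k ** left_product ?D ks) I J"
        using minor_product_pos_iff[OF D snoc.prems IH(2)] K IH(3)[OF K(1)] by blast
    qed
    then show ?case
      using minor_product_nonneg[OF assms(1) snoc.prems IH(1)]
        minor_product_nonneg[OF D snoc.prems IH(2)]
      by (simp add: left_product_snoc)
  qed
  then show "0 \<le> minor (left_product C ks) I J" "0 \<le> minor (left_product ?D ks) I J"
    "0 < minor (left_product C ks) I J \<Longrightarrow> 0 < minor (left_product ?D ks) I J"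
    by blast+
qed

lemma totally_positive_left_product_scaled:
  fixes C :: "nat \<Rightarrow> real ^ 'n::{finite,linorder} ^ 'n::{finite,linorder}"
  assumes "\<And>k. totally_nonnegative (C k)" and "\<And>k j. 0 < d k j" and "ks \<noteq> []"
    and "totally_positive (left_product C ks)"
  shows "totally_positive (left_product (\<lambda>k. \<chi> i j. C k $ i $ j * d k j) ks)"
  unfolding totally_positive_def
proof (intro allI impI)
  fix I J :: "'n::{finite,linorder} set"
  assume IJ: "I \<noteq> {} \<and> card I = card J"
  then have "0 < minor (left_product C ks) I J"
    using assms(4) by (simp add: totally_positive_def)
  then show "0 < minor (left_product (\<lambda>k. \<chi> i j. C k $ i $ j * d k j) ks) I J"
    using minor_left_product_scaled(3)[OF assms(1-3)] IJ by simp
qed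

section \<open>Cramer's rule and alternating null vectors\<close>

abbreviation select ::
  "real ^ 'n::{finite,linorder} ^ 'm::{finite,linorder} \<Rightarrow> 'm set \<Rightarrow> 'n set \<Rightarrow> real Matrix.mat" where
  "select A I J \<equiv> Matrix.mat (card I) (card J) (\<lambda>(i, j). A $ nth_elem I i $ nth_elem J j)"

lemma det_select_delete:
  fixes A :: "real ^ 'n::{finite,linorder} ^ 'm::{finite,linorder}"
  assumes "i < card I" "j < card J"
  shows "Determinant.det (mat_delete (select A I J) i j)
    = minor A (I - {nth_elem I i}) (J - {nth_elem J j})"
proof -
  have c: "card (I - {nth_elem I i}) = card I - 1" "card (J - {nth_elem J j}) = card J - 1"
    using assms nth_elem_in[of I i] nth_elem_in[of J j] by auto
  have "mat_delete (select A I J) i j = select A (I - {nth_elem I i}) (J - {nth_elem J j})"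
    using assms by (intro eq_matI)
      (auto simp: c mat_delete_def nth_elem_remove insert_index_def)
  then show ?thesis
    by (simp add: minor_nth_elem)
qed

lemma matrix_vector_nth_elem:
  fixes A :: "real ^ 'n::{finite,linorder} ^ 'm::{finite,linorder}"
  assumes "\<And>j. j \<notin> J \<Longrightarrow> x $ j = 0"
  shows "(A *v x) $ i = (\<Sum>s<card J. A $ i $ nth_elem J s * x $ nth_elem J s)"
proof -
  have "(A *v x) $ i = (\<Sum>j\<in>J. A $ i $ j * x $ j)"
    unfolding matrix_vector_mult_def using assms
    by (auto intro!: sum.mono_neutral_right)
  also have "\<dots> = (\<Sum>s<card J. A $ i $ nth_elem J s * x $ nth_elem J s)"
    using sum.reindex_bij_betw[OF bij_betw_nth_elem[of J], of "\<lambda>j. A $ i $ j * x $ j"]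
    by (simp add: lessThan_atLeast0)
  finally show ?thesis .
qed

text \<open>Since \<open>x\<close> vanishes off \<open>J\<close>, the rows \<open>I\<close> of
  \<open>A *v x\<close> are the square block on \<open>I\<close> and \<open>J\<close> applied to the
  entries of \<open>x\<close> on \<open>J\<close>; multiplying by row \<open>s\<close> of the
  adjugate isolates one entry.\<close>

lemma Cramer_minor:
  fixes A :: "real ^ 'n::{finite,linorder} ^ 'm::{finite,linorder}"
  assumes "card I = m" "card J = m" "\<And>j. j \<notin> J \<Longrightarrow> x $ j = 0" "s < m"
  shows "minor A I J * x $ nth_elem J s = (\<Sum>k<m. (-1) ^ (k + s) *
    minor A (I - {nth_elem I k}) (J - {nth_elem J s}) * (A *v x) $ nth_elem I k)"
proof -
  define B where "B = select A I J"
  have B: "B \<in> carrier_mat m m"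
    using assms by (simp add: B_def)
  have B_nth: "B $$ (k, t) = A $ nth_elem I k $ nth_elem J t" if "k < m" "t < m" for k t
    using assms that by (simp add: B_def)
  have cof: "cofactor B k s = (-1) ^ (k + s) * minor A (I - {nth_elem I k}) (J - {nth_elem J s})"
    if "k < m" for k
    unfolding cofactor_def B_def using assms that by (subst det_select_delete) auto
  have adj: "(\<Sum>k<m. cofactor B k s * B $$ (k, t)) = (if s = t then minor A I J else 0)"
    if "t < m" for t
  proof -
    have "(adj_mat B * B) $$ (s, t) = (\<Sum>k<m. cofactor B k s * B $$ (k, t))"
      using B assms that by (simp add: times_mat_def scalar_prod_def adj_mat_def lessThan_atLeast0)
    moreover have "Determinant.det B = minor A I J"
      by (simp add: B_def minor_nth_elem)
    ultimately show ?thesis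
      using adj_mat(3)[OF B] assms that by (simp split: if_splits)
  qed
  have "(\<Sum>k<m. (-1) ^ (k + s) *
      minor A (I - {nth_elem I k}) (J - {nth_elem J s}) * (A *v x) $ nth_elem I k)
    = (\<Sum>k<m. cofactor B k s * (\<Sum>t<m. B $$ (k, t) * x $ nth_elem J t))"
    using assms by (simp add: cof B_nth matrix_vector_nth_elem[OF assms(3)])
  also have "\<dots> = (\<Sum>k<m. \<Sum>t<m. cofactor B k s * B $$ (k, t) * x $ nth_elem J t)"
    by (simp add: sum_distrib_left mult.assoc)
  also have "\<dots> = (\<Sum>t<m. (\<Sum>k<m. cofactor B k s * B $$ (k, t)) * x $ nth_elem J t)"
    by (subst sum.swap) (simp add: sum_distrib_right)
  also have "\<dots> = (\<Sum>t<m. if s = t then minor A I J * x $ nth_elem J t else 0)"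
    by (intro sum.cong) (simp_all add: adj)
  also have "\<dots> = minor A I J * x $ nth_elem J s"
    using assms(4) by simp
  finally show ?thesis ..
qed

text \<open>The rows \<open>I\<close> on the columns \<open>J\<close> form a block with one column
  too many. Its maximal minors, taken with alternating signs, are orthogonal to every row, and total
  positivity makes these minors positive.\<close>

lemma alternating_null_vector:
  fixes A :: "real ^ 'n::{finite,linorder} ^ 'm::{finite,linorder}"
  assumes "totally_positive A" "I \<noteq> {}" "card J = Suc (card I)"
  obtains v where "\<And>j. j \<notin> J \<Longrightarrow> v $ j = 0" "\<And>s. s < card J \<Longrightarrow> 0 < (-1) ^ s * v $ nth_elem J s"
    "\<And>i. i \<in> I \<Longrightarrow> (A *v v) $ i = 0"
proof -
  define m where "m = card I"
  have m: "card I = m" "card J = Suc m"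
    using assms by (auto simp: m_def)
  \<comment> \<open>A zero row at position \<open>m\<close> makes the block square; the cofactors
    along that row are the signed maximal minors.\<close>
  let ?B = "Matrix.mat (Suc m) (Suc m)
    (\<lambda>(i, j). if i < m then A $ nth_elem I i $ nth_elem J j else 0)"
  have B: "?B \<in> carrier_mat (Suc m) (Suc m)"
    by simp
  define c where "c s = minor A I (J - {nth_elem J s})" for s
  have c_pos: "0 < c s" if "s < Suc m" for s
    using assms(1,2) nth_elem_in[of J s] m that by (simp add: totally_positive_def c_def)
  have cof: "cofactor ?B m s = (-1) ^ m * ((-1) ^ s * c s)" if "s < Suc m" for s
  proof -
    have "card (J - {nth_elem J s}) = m"
      using nth_elem_in[of J s] m that by simp
    then have "mat_delete ?B m s = select A I (J - {nth_elem J s})"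
      using m that by (intro eq_matI) (auto simp: mat_delete_def nth_elem_remove insert_index_def)
    then show ?thesis
      by (simp add: cofactor_def c_def minor_nth_elem power_add)
  qed
  \<comment> \<open>Entry \<open>(k, m)\<close> of \<open>?B\<close> times its adjugate lies off the
    diagonal, hence is zero; the common factor \<open>(-1) ^ m\<close> then cancels.\<close>
  have adj: "(\<Sum>s<Suc m. A $ nth_elem I k $ nth_elem J s * ((-1) ^ s * c s)) = 0" if "k < m" for k
  proof -
    have "(?B * adj_mat ?B) $$ (k, m) = (\<Sum>s<Suc m. ?B $$ (k, s) * cofactor ?B m s)"
      using that by (simp add: times_mat_def scalar_prod_def adj_mat_def lessThan_atLeast0
        del: sum.lessThan_Suc sum.op_ivl_Suc)
    also have "\<dots> = (-1) ^ m * (\<Sum>s<Suc m. A $ nth_elem I k $ nth_elem J s * ((-1) ^ s * c s))"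
      unfolding sum_distrib_left using that by (intro sum.cong) (simp_all add: cof)
    finally show ?thesis
      using adj_mat(2)[OF B] that by simp
  qed
  \<comment> \<open>At most one term of the sum is nonzero, as distinct positions hold distinct
    elements of \<open>J\<close>; it reads off the position of \<open>j\<close> and leaves 0 off
    \<open>J\<close>.\<close>
  define v :: "real ^ 'n::{finite,linorder}" where
    "v = (\<chi> j. \<Sum>s<Suc m. if j = nth_elem J s then (-1) ^ s * c s else 0)"
  have inj: "nth_elem J s = nth_elem J t \<longleftrightarrow> s = t" if "s < Suc m" "t < Suc m" for s t
    using bij_betw_nth_elem[of J] m that by (auto simp: bij_betw_def inj_on_eq_iff)
  have v_nth: "v $ nth_elem J s = (-1) ^ s * c s" if "s < Suc m" for s
  proof -
    have "v $ nth_elem J s = (\<Sum>t<Suc m. if s = t then (-1) ^ t * c t else 0)"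
      unfolding v_def using that inj by (auto intro!: sum.cong)
    then show ?thesis
      using that by (simp del: sum.lessThan_Suc)
  qed
  have v_out: "v $ j = 0" if "j \<notin> J" for j
  proof -
    have "j \<noteq> nth_elem J s" if "s < Suc m" for s
      using nth_elem_in[of J s] m that \<open>j \<notin> J\<close> by auto
    then show ?thesis
      by (simp add: v_def del: sum.lessThan_Suc)
  qed
  show ?thesis
  proof (rule that)
    show "v $ j = 0" if "j \<notin> J" for j
      by (rule v_out) fact
    show "0 < (-1) ^ s * v $ nth_elem J s" if "s < card J" for s
    proof -
      have "(-1) ^ s * v $ nth_elem J s = ((-1) ^ s * (-1) ^ s) * c s"
        using v_nth m that by simp
      then show ?thesis
        using c_pos m that by (simp flip: power_mult_distrib)
    qed
    show "(A *v v) $ i = 0" if i: "i \<in> I" for i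
    proof -
      obtain k where "k < card I" and k: "i = nth_elem I k"
        using ex_nth_elem[OF finite i] .
      have "(A *v v) $ i = (\<Sum>s<Suc m. A $ i $ nth_elem J s * ((-1) ^ s * c s))"
        using matrix_vector_nth_elem[of J v A i, OF v_out] m by (simp add: v_nth del: sum.lessThan_Suc)
      then show ?thesis
        using adj[of k] \<open>k < card I\<close> k m by simp
    qed
  qed
qed

section \<open>Variation diminution\<close>

text \<open>Only the sign of \<open>d\<close> matters: it is the sign of the first entry. A nonempty
  alternating set of \<open>m\<close> indices witnesses \<open>m - 1\<close> strict sign
  changes.\<close>

definition alternating :: "real \<Rightarrow> real ^ 'n::{finite,linorder} \<Rightarrow> 'n set \<Rightarrow> bool" where
  "alternating d x I \<longleftrightarrow> (\<forall>k<card I. 0 < d * (-1) ^ k * x $ nth_elem I k)"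

text \<open>Zero entries may count with either sign, as in the maximal count of sign
  changes.\<close>

definition weakly_alternating :: "real \<Rightarrow> real ^ 'n::{finite,linorder} \<Rightarrow> 'n set \<Rightarrow> bool" where
  "weakly_alternating d x I \<longleftrightarrow> (\<forall>k<card I. 0 \<le> d * (-1) ^ k * x $ nth_elem I k)"

lemma alternating_imp_weakly: "alternating d x I \<Longrightarrow> weakly_alternating d x I"
  by (auto simp: alternating_def weakly_alternating_def intro: less_imp_le)

lemma pos_mult_transfer:
  fixes d e y :: real
  assumes "0 < e * y" "0 < e * d"
  shows "0 < d * y"
  using assms by (auto simp: zero_less_mult_iff)

text \<open>Dropping the last index keeps the initial sign, dropping the first one flips it; one of
  the two gives the sign of \<open>d\<close>.\<close>

lemma alternating_shorten:
  fixes x :: "real ^ 'n::{finite,linorder}"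
  assumes "alternating e x J" "card J = Suc m" "d \<noteq> 0" "e \<noteq> 0"
  shows "\<exists>J'. card J' = m \<and> alternating d x J'"
proof (cases "0 < e * d")
  case True
  let ?J = "J - {nth_elem J m}"
  have c: "card ?J = m"
    using assms(2) nth_elem_in[of J m] by simp
  have "0 < d * (-1) ^ k * x $ nth_elem ?J k" if "k < m" for k
  proof -
    have "nth_elem ?J k = nth_elem J k"
      using nth_elem_remove[of J m k] assms(2) that by simp
    moreover have "0 < e * ((-1) ^ k * x $ nth_elem J k)"
      using assms(1,2) that by (simp add: alternating_def mult.assoc)
    ultimately show ?thesis
      using pos_mult_transfer[OF _ True] by (simp add: mult.assoc)
  qed
  then show ?thesis
    using c by (intro exI[of _ ?J]) (simp add: alternating_def)
next
  case False
  then have neg: "0 < - e * d"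
    using assms(3,4) by (cases "e * d" "0 :: real" rule: linorder_cases) auto
  let ?J = "J - {nth_elem J 0}"
  have c: "card ?J = m"
    using assms(2) nth_elem_in[of J 0] by simp
  have "0 < d * (-1) ^ k * x $ nth_elem ?J k" if "k < m" for k
  proof -
    have "nth_elem ?J k = nth_elem J (Suc k)"
      using nth_elem_remove[of J 0 k] assms(2) that by simp
    moreover have "0 < e * (-1) ^ Suc k * x $ nth_elem J (Suc k)"
      using assms(1,2) that unfolding alternating_def by auto
    then have "0 < - e * ((-1) ^ k * x $ nth_elem J (Suc k))"
      by (simp add: mult.assoc)
    ultimately show ?thesis
      using pos_mult_transfer[OF _ neg] by (simp add: mult.assoc)
  qed
  then show ?thesis
    using c by (intro exI[of _ ?J]) (simp add: alternating_def)
qed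

text \<open>The empty minor, which the definition leaves out, equals 1; it occurs when a row and a
  column are removed from a one-by-one block.\<close>

lemma totally_positive_minor_pos:
  assumes "totally_positive A" "card I = card J"
  shows "0 < minor A I J"
proof (cases "I = {}")
  case True
  then show ?thesis
    using assms(2) by (simp add: minor_nth_elem)
next
  case False
  then show ?thesis
    using assms by (simp add: totally_positive_def)
qed

text \<open>Cramer's rule writes each entry of \<open>x\<close> on \<open>J\<close> as a combination
  of the entries of \<open>A *v x\<close> on \<open>I\<close> whose coefficients have the signs of
  \<open>(-1) ^ (k + s)\<close>. Weak alternation makes all terms agree in sign, and one of them is
  nonzero.\<close>

lemma variation_diminishing_small_support:
  fixes A :: "real ^ 'n::{finite,linorder} ^ 'm::{finite,linorder}"
  assumes "totally_positive A" "card J = card I" "\<And>j. j \<notin> J \<Longrightarrow> x $ j = 0" "x \<noteq> 0"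
    and "weakly_alternating d (A *v x) I" "d \<noteq> 0"
  shows "alternating d x J"
proof -
  define m where "m = card I"
  have m: "card I = m" "card J = m"
    using assms(2) by (auto simp: m_def)
  let ?y = "\<lambda>k. (A *v x) $ nth_elem I k"
  let ?M = "\<lambda>k s. minor A (I - {nth_elem I k}) (J - {nth_elem J s})"
  note Cramer = Cramer_minor[OF m assms(3), of _ A]
  have det: "0 < minor A I J"
    using assms(1,2) by (simp add: totally_positive_minor_pos)
  have M: "0 < ?M k s" if "k < m" "s < m" for k s
    using assms(1) m that nth_elem_in[of I k] nth_elem_in[of J s]
    by (intro totally_positive_minor_pos) simp_all
  have "\<exists>k<m. ?y k \<noteq> 0"
  proof (rule ccontr)
    assume "\<not> (\<exists>k<m. ?y k \<noteq> 0)"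
    then have "minor A I J * x $ nth_elem J s = 0" if "s < m" for s
      using Cramer[OF _ that] by simp
    then have "x $ nth_elem J s = 0" if "s < m" for s
      using that det by simp
    then have "x $ j = 0" for j
      using assms(3)[of j] ex_nth_elem[of J j] m by (metis finite)
    then show False
      using \<open>x \<noteq> 0\<close> by (simp add: Finite_Cartesian_Product.vec_eq_iff)
  qed
  then obtain k where k: "k < m" "?y k \<noteq> 0"
    by blast
  have "0 < d * (-1) ^ s * x $ nth_elem J s" if "s < m" for s
  proof -
    have "0 < (\<Sum>k<m. ?M k s * (d * (-1) ^ k * ?y k))"
    proof (rule sum_pos2[of _ k])
      have "0 \<le> d * (-1) ^ k * ?y k" "d * (-1) ^ k * ?y k \<noteq> 0"
        using assms(5,6) m k by (simp_all add: weakly_alternating_def)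
      then have "0 < d * (-1) ^ k * ?y k"
        by (metis order_le_less)
      then show "0 < ?M k s * (d * (-1) ^ k * ?y k)"
        by (rule mult_pos_pos[OF M[OF k(1) that]])
      show "0 \<le> ?M l s * (d * (-1) ^ l * ?y l)" if "l \<in> {..<m}" for l
        using assms(5) m M[of l s] that \<open>s < m\<close>
        by (intro mult_nonneg_nonneg[of "?M l s"]) (simp_all add: weakly_alternating_def less_imp_le)
    qed (use k in auto)
    also have "\<dots> = (\<Sum>k<m. d * (-1) ^ s * ((-1) ^ (k + s) * ?M k s * ?y k))"
      by (intro sum.cong) (simp_all add: power_add mult_ac flip: power_mult_distrib)
    also have "\<dots> = d * (-1) ^ s * (minor A I J * x $ nth_elem J s)"
      unfolding Cramer[OF _ that, simplified] sum_distrib_left ..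
    finally have "0 < minor A I J * (d * (-1) ^ s * x $ nth_elem J s)"
      by (simp add: mult_ac)
    then show ?thesis
      using det by (simp add: zero_less_mult_iff)
  qed
  then show ?thesis
    using m by (simp add: alternating_def)
qed

text \<open>A solution of \<open>A x = y\<close> on the rows \<open>I\<close> whose support is too large is moved along a null
  vector with alternating signs until a coordinate vanishes; no coordinate changes sign on the
  way, and if the motion could kill all coordinates at once, \<open>x\<close> itself alternates.\<close>

lemma variation_diminishing:
  fixes A :: "real ^ 'n::{finite,linorder} ^ 'm::{finite,linorder}"
  assumes "totally_positive A" "I \<noteq> {}" "card I \<le> CARD('n)" "d \<noteq> 0"
    and "x \<noteq> 0" "weakly_alternating d (A *v x) I"
  shows "\<exists>J. card J = card I \<and> alternating d x J"
  using assms(5,6)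
\<comment> \<open>Induction on the size of the support, which the move along the null vector
  lowers.\<close>
proof (induction "card {j. x $ j \<noteq> 0}" arbitrary: x rule: less_induct)
  case less
  show ?case
  proof (cases "card {j. x $ j \<noteq> 0} \<le> card I")
    case True
    then obtain J where J: "{j. x $ j \<noteq> 0} \<subseteq> J" "card J = card I"
      using exists_subset_between[of "{j. x $ j \<noteq> 0}" "card I" UNIV] assms(3) by auto
    then have "alternating d x J"
      using less.prems assms(1,4) by (intro variation_diminishing_small_support[where A = A]) auto
    then show ?thesis
      using J by blast
  next
    case False
    then obtain J where J: "J \<subseteq> {j. x $ j \<noteq> 0}" "card J = Suc (card I)"
      using obtain_subset_with_card_n[of "Suc (card I)" "{j. x $ j \<noteq> 0}"] by auto
    obtain v where v_out: "\<And>j. j \<notin> J \<Longrightarrow> v $ j = 0"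
      and v_alt: "\<And>s. s < card J \<Longrightarrow> 0 < (-1) ^ s * v $ nth_elem J s"
      and v_null: "\<And>i. i \<in> I \<Longrightarrow> (A *v v) $ i = 0"
      using alternating_null_vector[OF assms(1,2) J(2)] by blast
    have nz: "x $ j * v $ j \<noteq> 0" if "j \<in> J" for j
    proof -
      obtain s where "s < card J" "j = nth_elem J s"
        using ex_nth_elem[OF finite \<open>j \<in> J\<close>] .
      then show ?thesis
        using v_alt[of s] J(1) that by auto
    qed
    \<comment> \<open>When a positive multiple of \<open>v\<close> is subtracted, the entries of
      \<open>x\<close> in \<open>P\<close> start to move towards zero, those in the rest of
      \<open>J\<close> away from it.\<close>
    define P where "P = {j \<in> J. 0 < x $ j * v $ j}"
    show ?thesis
    proof (cases "P = {} \<or> P = J")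
      case True
      \<comment> \<open>On all of \<open>J\<close> the signs of \<open>x\<close> agree with those of
        \<open>v\<close>, or all are opposite. Either way \<open>x\<close> alternates along
        \<open>J\<close>, which has one index more than required.\<close>
      define e :: real where "e = (if P = J then 1 else -1)"
      have "0 < e * (-1) ^ s * x $ nth_elem J s" if "s < card J" for s
      proof -
        have "nth_elem J s \<in> J"
          using nth_elem_in[OF finite that] .
        then have "0 < e * (x $ nth_elem J s * v $ nth_elem J s)"
          using True nz[of "nth_elem J s"] by (auto simp: e_def P_def)
        then have "0 < (v $ nth_elem J s) * (e * x $ nth_elem J s)"
          by (simp add: mult_ac)
        moreover have "0 < v $ nth_elem J s * (-1) ^ s"
          using v_alt[OF that] by (simp add: mult_ac)
        ultimately have "0 < (-1) ^ s * (e * x $ nth_elem J s)"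
          by (rule pos_mult_transfer)
        then show ?thesis
          by (simp add: mult_ac)
      qed
      then have "alternating e x J"
        by (simp add: alternating_def)
      then show ?thesis
        using alternating_shorten[OF _ J(2) assms(4)] by (simp add: e_def split: if_splits)
    next
      case False
      \<comment> \<open>The smallest ratio is the first time at which an entry in \<open>P\<close>
        reaches zero.\<close>
      define t where "t = Min ((\<lambda>j. x $ j / v $ j) ` P)"
      have "t \<in> (\<lambda>j. x $ j / v $ j) ` P"
        unfolding t_def using False by (intro Min_in) auto
      then obtain p where p: "p \<in> P" "t = x $ p / v $ p"
        by blast
      have t_le: "t \<le> x $ j / v $ j" if "j \<in> P" for j
        unfolding t_def using that by (intro Min_le) auto
      have t_pos: "0 < t"
        using p by (auto simp: P_def zero_less_mult_iff zero_less_divide_iff)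
      define x' where "x' = x - t *\<^sub>R v"
      have x'_nth: "x' $ j = x $ j - t * v $ j" for j
        by (simp add: x'_def)
      have same_sign: "0 < x $ j * x' $ j" if "x' $ j \<noteq> 0" for j
      proof -
        consider "j \<notin> J" | "j \<in> P" | "j \<in> J" "x $ j * v $ j < 0"
          using nz[of j]
          by (cases "x $ j * v $ j" "0 :: real" rule: linorder_cases) (auto simp: P_def)
        then show ?thesis
        proof cases
          case 1
          then show ?thesis
            using that v_out[OF 1] by (auto simp: x'_nth zero_less_mult_iff)
        next
          case 2
          then have "x $ j * x' $ j = (x $ j * v $ j) * (x $ j / v $ j - t)"
            by (auto simp: x'_nth P_def field_simps)
          moreover have "0 \<le> (x $ j * v $ j) * (x $ j / v $ j - t)"
            using 2 t_le[OF 2] by (intro mult_nonneg_nonneg[of "x $ j * v $ j"]) (simp_all add: P_def)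
          ultimately have "0 \<le> x $ j * x' $ j"
            by (simp only:)
          moreover have "x $ j * x' $ j \<noteq> 0"
            using 2 that by (auto simp: P_def)
          ultimately show ?thesis
            by (metis order_le_less)
        next
          case 3
          have "x $ j * x' $ j = x $ j * x $ j + t * - (x $ j * v $ j)"
            by (simp add: x'_nth algebra_simps)
          moreover have "0 < t * - (x $ j * v $ j)"
            using 3 t_pos by (intro mult_pos_pos) auto
          ultimately show ?thesis
            using zero_le_square[of "x $ j"] by linarith
        qed
      qed
      have "x' $ p = 0"
        using p by (auto simp: x'_nth P_def)
      moreover have "x $ p \<noteq> 0"
        using p by (auto simp: P_def)
      ultimately have "{j. x' $ j \<noteq> 0} \<subset> {j. x $ j \<noteq> 0}"
        using same_sign by fastforce
      then have "card {j. x' $ j \<noteq> 0} < card {j. x $ j \<noteq> 0}"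
        by (intro psubset_card_mono) auto
      moreover have "x' \<noteq> 0"
      proof -
        \<comment> \<open>An entry in \<open>J\<close> outside \<open>P\<close> has the sign
          opposite to \<open>v\<close>, so subtracting a positive multiple of \<open>v\<close>
          cannot cancel it.\<close>
        obtain j where j: "j \<in> J" "j \<notin> P"
          using False by (auto simp: P_def)
        then have "x $ j * v $ j < 0"
          using nz[of j]
          by (cases "x $ j * v $ j" "0 :: real" rule: linorder_cases) (auto simp: P_def)
        moreover have "x $ j = t * v $ j" if "x' = 0"
          using x'_nth[of j] that by simp
        ultimately show ?thesis
          using t_pos by (auto simp: mult_less_0_iff zero_less_mult_iff)
      qed
      moreover have "weakly_alternating d (A *v x') I"
      proof -
        have "(A *v x') $ nth_elem I k = (A *v x) $ nth_elem I k" if "k < card I" for k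
          using v_null[OF nth_elem_in[OF finite that]]
          by (simp add: x'_def matrix_vector_mult_diff_distrib matrix_vector_mult_scaleR)
        then show ?thesis
          using less.prems(2) by (simp add: weakly_alternating_def)
      qed
      ultimately obtain K where K: "card K = card I" "alternating d x' K"
        using less.hyps by blast
      \<comment> \<open>Entries that are nonzero after the move had the same sign before it, so the
        alternation passes from \<open>x'\<close> back to \<open>x\<close>.\<close>
      have "0 < d * (-1) ^ s * x $ nth_elem K s" if "s < card K" for s
      proof -
        have *: "0 < d * (-1) ^ s * x' $ nth_elem K s"
          using K(2) that by (simp add: alternating_def)
        then have "0 < x $ nth_elem K s * x' $ nth_elem K s"
          by (intro same_sign) auto
        then have "0 < x' $ nth_elem K s * x $ nth_elem K s"
          by (simp add: mult.commute)
        moreover have "0 < x' $ nth_elem K s * (d * (-1) ^ s)"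
          using * by (simp add: mult_ac)
        ultimately show ?thesis
          by (rule pos_mult_transfer)
      qed
      then show ?thesis
        using K(1) unfolding alternating_def by blast
    qed
  qed
qed

section \<open>Orbits of totally positive matrices\<close>

lemma totally_positive_kernel:
  fixes A :: "real ^ 'n::{finite,linorder} ^ 'n::{finite,linorder}"
  assumes "totally_positive A" "A *v x = 0"
  shows "x = 0"
proof -
  have "x $ j = 0" for j
  proof -
    obtain s where s: "s < CARD('n)" "j = nth_elem UNIV s"
      using ex_nth_elem[of UNIV j] by auto
    have "minor A UNIV UNIV * x $ j = 0"
      using Cramer_minor[of UNIV "CARD('n)" UNIV x s A] s assms(2) by simp
    then show ?thesis
      using totally_positive_minor_pos[OF assms(1), of UNIV UNIV] by simp
  qed
  then show ?thesis
    by (simp add: Finite_Cartesian_Product.vec_eq_iff)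
qed

text \<open>The longest alternation length \<open>q\<close> cannot grow along the orbit, so it is
  eventually constant. From then on the first coordinate carries the initial sign of every longest
  alternation: otherwise prepending it would give a weak alternation of length \<open>q + 1\<close>,
  and one step earlier a strict one.\<close>

lemma totally_positive_orbit_first_sign:
  fixes A :: "nat \<Rightarrow> real ^ 'n::{finite,linorder} ^ 'n::{finite,linorder}"
  assumes "\<And>j. totally_positive (A j)" "\<And>j. w (Suc j) = A j *v w j" "w 0 \<noteq> 0" "\<And>i. a \<le> i"
  obtains e :: real and N where "\<And>j. N \<le> j \<Longrightarrow> 0 < e * w j $ a"
proof -
  have nz: "w j \<noteq> 0" for j
  proof (induction j)
    case (Suc j)
    then show ?case
      using totally_positive_kernel[OF assms(1)] assms(2) by metis
  qed (rule assms(3))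
  have vd: "\<exists>J. card J = card I \<and> alternating d (w j) J"
    if "weakly_alternating d (w (Suc j)) I" "I \<noteq> {}" "d \<noteq> 0" for d j I
    using variation_diminishing[OF assms(1)[of j] that(2) _ that(3) nz[of j]] that(1) assms(2)
    by (simp add: card_mono)
  define Alt where "Alt j = {m. \<exists>d I. d \<noteq> 0 \<and> card I = m \<and> alternating d (w j) I}" for j
  have fin: "finite (Alt j)" for j
  proof (rule finite_subset)
    show "Alt j \<subseteq> {..CARD('n)}"
      by (auto simp: Alt_def intro: card_mono)
  qed simp
  have one: "1 \<in> Alt j" for j
  proof -
    obtain i where "w j $ i \<noteq> 0"
      using nz[of j] by (auto simp: Finite_Cartesian_Product.vec_eq_iff)
    then have "alternating (w j $ i) (w j) {i}"
      by (auto simp: alternating_def nth_elem_def zero_less_mult_iff)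
    then show ?thesis
      unfolding Alt_def using \<open>w j $ i \<noteq> 0\<close> by (intro CollectI exI[of _ "w j $ i"] exI[of _ "{i}"]) simp
  qed
  define q where "q j = Max (Alt j)" for j
  have q_in: "q j \<in> Alt j" for j
    unfolding q_def using fin one by (intro Max_in) auto
  have q_ge: "m \<le> q j" if "m \<in> Alt j" for m j
    unfolding q_def using fin that by (intro Max_ge)
  have q_pos: "1 \<le> q j" for j
    using q_ge one .
  have q_Suc: "q (Suc j) \<le> q j" for j
  proof -
    obtain d I where dI: "d \<noteq> 0" "card I = q (Suc j)" "alternating d (w (Suc j)) I"
      using q_in[of "Suc j"] by (auto simp: Alt_def)
    moreover have "I \<noteq> {}"
      using dI(2) q_pos[of "Suc j"] by auto
    ultimately obtain J where "card J = q (Suc j)" "alternating d (w j) J"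
      using vd[OF alternating_imp_weakly] by metis
    then show ?thesis
      using dI(1) by (intro q_ge) (auto simp: Alt_def)
  qed
  obtain N where "\<And>j. q N \<le> q j"
    using ex_has_least_nat[of "\<lambda>_. True" _ q] by auto
  then have q_const: "q j = q N" if "N \<le> j" for j
    using lift_Suc_antimono_le[of q, OF q_Suc that] by (simp add: le_antisym)
  have first: "0 < d * w (Suc j) $ a"
    if dI: "d \<noteq> 0" "card I = q N" "alternating d (w (Suc j)) I" and j: "N \<le> j" for d I j
  proof (rule ccontr)
    assume neg: "\<not> 0 < d * w (Suc j) $ a"
    have "a \<notin> I"
    proof
      assume "a \<in> I"
      then obtain k where k: "k < card I" "a = nth_elem I k"
        using ex_nth_elem[of I a] by auto
      have "k = 0"
      proof (rule ccontr)
        assume "k \<noteq> 0"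
        then have "nth_elem I 0 < a"
          using nth_elem_less[of 0 k I] k by simp
        then show False
          using assms(4)[of "nth_elem I 0"] by simp
      qed
      then show False
        using dI(3) k neg by (auto simp: alternating_def)
    qed
    then have c: "card (insert a I) = Suc (q N)"
      using dI(2) by simp
    have below: "a < i" if "i \<in> I" for i
      using assms(4)[of i] \<open>a \<notin> I\<close> that by (metis le_neq_trans)
    \<comment> \<open>Prepending \<open>a\<close> shifts the positions of \<open>I\<close> by one,
      hence the change from \<open>d\<close> to \<open>- d\<close>.\<close>
    have "0 \<le> - d * (-1) ^ k * w (Suc j) $ nth_elem (insert a I) k" if "k < Suc (q N)" for k
    proof (cases k)
      case 0
      then show ?thesis
        using nth_elem_insert_below[OF finite below, where k = 0] neg by simp
    next
      case (Suc l)
      then have "nth_elem (insert a I) k = nth_elem I l" "l < card I"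
        using nth_elem_insert_below[OF finite below, where k = k] that dI(2) by auto
      then show ?thesis
        using dI(3) Suc by (auto simp: alternating_def intro: less_imp_le)
    qed
    then have "weakly_alternating (- d) (w (Suc j)) (insert a I)"
      unfolding weakly_alternating_def c by blast
    then obtain J where "card J = Suc (q N)" "alternating (- d) (w j) J"
      using vd[of "- d" j "insert a I"] dI(1) c by auto
    then have "Suc (q N) \<in> Alt j"
      using dI(1) unfolding Alt_def by (intro CollectI exI[of _ "- d"] exI[of _ J]) simp
    then show False
      using q_ge[of "Suc (q N)" j] q_const[OF j] by simp
  qed
  obtain e I where e: "e \<noteq> 0" "card I = q N" "alternating e (w (Suc N)) I"
    using q_in[of "Suc N"] q_const[of "Suc N"] by (auto simp: Alt_def)
  have "0 < e * w (Suc j) $ a" if "N \<le> j" for j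
    using that
  proof (induction j rule: dec_induct)
    case base
    then show ?case
      using first[OF e] by simp
  next
    case (step j)
    \<comment> \<open>Variation diminution keeps \<open>d\<close>, so a longest alternation at time
      \<open>j + 2\<close> has a counterpart at time \<open>j + 1\<close> with the same initial
      sign; the first coordinates at both times thus share the sign of \<open>d\<close>.\<close>
    obtain d K where d: "d \<noteq> 0" "card K = q N" "alternating d (w (Suc (Suc j))) K"
      using q_in[of "Suc (Suc j)"] q_const[of "Suc (Suc j)"] step.hyps by (auto simp: Alt_def)
    moreover have "K \<noteq> {}"
      using d(2) q_pos[of N] by auto
    ultimately obtain J where "card J = q N" "alternating d (w (Suc j)) J"
      using vd[OF alternating_imp_weakly] by metis
    then have "0 < d * w (Suc j) $ a"
      using first[OF d(1)] step.hyps by simp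
    then have "0 < d * e"
      using step.IH by (auto simp: zero_less_mult_iff)
    moreover have "0 < d * w (Suc (Suc j)) $ a"
      using first[OF d] step.hyps by simp
    ultimately show ?case
      using pos_mult_transfer by blast
  qed
  then have "0 < e * w j $ a" if "Suc N \<le> j" for j
    using that by (cases j) auto
  then show ?thesis
    by (rule that)
qed

section \<open>Convergence of bounded solutions\<close>

lemma left_product_upt:
  assumes "\<And>k. z (Suc k) = M k *v z k"
  shows "z (k + l) = left_product M [k..<k + l] *v z k"
proof (induction l)
  case 0
  then show ?case
    by (simp add: left_product_def)
next
  case (Suc l)
  then show ?case
    using assms[of "k + l"] by (simp add: left_product_snoc matrix_vector_mul_assoc)
qed

text \<open>The value 1 on the diagonal is a positive default: there it only multiplies the zero
  difference \<open>a - b\<close>.\<close>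

definition slope :: "(real \<Rightarrow> real) \<Rightarrow> real \<Rightarrow> real \<Rightarrow> real" where
  "slope g a b = (if a = b then 1 else (g a - g b) / (a - b))"

lemma slope_pos: "strict_mono g \<Longrightarrow> 0 < slope g a b"
  by (cases a b rule: linorder_cases)
    (auto simp: slope_def strict_mono_less zero_less_divide_iff)

lemma slope_mult: "slope g a b * (a - b) = g a - g b"
  by (simp add: slope_def)

section \<open>Solutions and their differences\<close>

lemma is_solution_shift:
  assumes "is_solution C f x" "\<And>k. C (k + u) = C k"
  shows "is_solution C f (\<lambda>k. x (k + u))"
  using assms by (simp add: is_solution_def algebra_simps)

lemma is_solution_unique:
  assumes "is_solution C f x" "is_solution C f y" "x 0 = y 0"
  shows "x k = y k"
  using assms by (induction k) (simp_all add: is_solution_def)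

lemma is_solution_exists:
  obtains x where "is_solution C f x" "x 0 = p"
proof
  show "is_solution C f (rec_nat p (\<lambda>k x. C k *v (\<chi> i. f i (x $ i))))"
    by (simp add: is_solution_def)
qed simp

lemma solution_difference:
  assumes "is_solution C f x" "is_solution C f y"
  shows "x (Suc k) - y (Suc k)
    = (\<chi> i j. C k $ i $ j * slope (f j) (x k $ j) (y k $ j)) *v (x k - y k)"
proof -
  have "x (Suc k) - y (Suc k) = C k *v ((\<chi> i. f i (x k $ i)) - (\<chi> i. f i (y k $ i)))"
    using assms by (simp add: is_solution_def matrix_vector_mult_diff_distrib)
  also have "\<dots> = (\<chi> i j. C k $ i $ j * slope (f j) (x k $ j) (y k $ j)) *v (x k - y k)"
    by (simp add: Finite_Cartesian_Product.vec_eq_iff matrix_vector_mult_def mult.assoc slope_mult)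
  finally show ?thesis .
qed

text \<open>The difference of two solutions follows a linear system whose matrices are those of
  \<open>C\<close> with columns scaled by positive slopes. Its products over \<open>h\<close>
  consecutive times are totally positive, so the sign statement for orbits applies along the times
  \<open>r + j * h\<close>.\<close>

lemma solutions_difference_first_sign:
  fixes C :: "nat \<Rightarrow> real ^ 'n::{finite,linorder} ^ 'n::{finite,linorder}"
  assumes "ODTS C h" "\<And>i. strict_mono (f i)" "\<And>i. a \<le> i"
    and sol: "is_solution C f x" "is_solution C f y" and "x 0 \<noteq> y 0"
  obtains e :: real and N where "\<And>j. N \<le> j \<Longrightarrow> 0 < e * (x (r + j * h) $ a - y (r + j * h) $ a)"
proof -
  define d where "d k j = slope (f j) (x k $ j) (y k $ j)" for k j
  define M where "M k = (\<chi> i j. C k $ i $ j * d k j)" for k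
  define z where "z k = x k - y k" for k
  define P where "P k = left_product M [k..<k + h]" for k
  have h: "1 \<le> h"
    using assms(1) by (simp add: ODTS_def)
  have z_Suc: "z (Suc k) = M k *v z k" for k
    using solution_difference[OF sol] by (simp add: z_def M_def d_def)
  have TP: "totally_positive (P k)" for k
    unfolding P_def M_def
  proof (rule totally_positive_left_product_scaled)
    show "totally_nonnegative (C k)" for k
      using assms(1) by (simp add: ODTS_def oscillatory_def)
    show "0 < d k j" for k j
      by (simp add: d_def slope_pos assms(2))
    show "[k..<k + h] \<noteq> []"
      using h by simp
    show "totally_positive (left_product C [k..<k + h])"
      using assms(1) by (simp add: ODTS_def)
  qed
  have z_h: "z (k + h) = P k *v z k" for k
    unfolding P_def by (rule left_product_upt[of z M k h, OF z_Suc])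
  have z_mult: "z (k * h) \<noteq> 0" for k
  proof (induction k)
    case 0
    then show ?case
      using assms(6) by (simp add: z_def)
  next
    case (Suc k)
    then show ?case
      using z_h[of "k * h"] totally_positive_kernel[OF TP] by (metis add.commute mult_Suc)
  qed
  \<comment> \<open>A zero at time \<open>r\<close> would persist at time \<open>r * h\<close>,
    which is not before \<open>r\<close> as \<open>h\<close> is at least 1.\<close>
  have "z r \<noteq> 0"
  proof
    assume "z r = 0"
    then have "z (r + (r * h - r)) = 0"
      using left_product_upt[of z M r "r * h - r", OF z_Suc] by simp
    then show False
      using z_mult[of r] h by simp
  qed
  then have z_0: "z (r + 0 * h) \<noteq> 0"
    by simp
  have "z (r + Suc j * h) = P (r + j * h) *v z (r + j * h)" for j
    using z_h[of "r + j * h"] by (simp add: add_ac)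
  from totally_positive_orbit_first_sign[of "\<lambda>j. P (r + j * h)" "\<lambda>j. z (r + j * h)" a,
      OF TP this z_0 assms(3)]
  obtain e N where "\<And>j. N \<le> j \<Longrightarrow> 0 < e * z (r + j * h) $ a"
    by blast
  then show ?thesis
    by (intro that[of N e]) (simp add: z_def)
qed

text \<open>By periodicity the shift of \<open>x\<close> by \<open>h * T\<close> is a solution too.
  Either it coincides with \<open>x\<close>, or the sign of the difference makes the sampled first
  coordinate eventually monotone.\<close>

lemma solution_first_coordinate_convergent:
  fixes C :: "nat \<Rightarrow> real ^ 'n::{finite,linorder} ^ 'n::{finite,linorder}"
  assumes "ODTS C h" "\<And>i. strict_mono (f i)" "\<And>i. a \<le> i" "T \<ge> 1"
    and sol: "is_solution C f x" and per: "\<And>k. C (k + h * T) = C k" and bdd: "bounded (range x)"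
  shows "convergent (\<lambda>j. x (r + j * (h * T)) $ a)"
proof -
  define u where "u = h * T"
  have sol': "is_solution C f (\<lambda>k. x (k + u))"
    using is_solution_shift[OF sol per] by (simp add: u_def)
  show ?thesis
    unfolding u_def[symmetric]
  proof (cases "x u = x 0")
    case True
    then have x_per: "x (k + u) = x k" for k
      using is_solution_unique[OF sol' sol] by simp
    have "x (r + j * u) = x r" for j
      using x_per[of "r + _ * u"] by (induction j) (simp_all add: add_ac)
    then show "convergent (\<lambda>j. x (r + j * u) $ a)"
      by (simp add: convergent_const)
  next
    case False
    define s where "s j = x (r + j * u) $ a" for j
    have ne: "x (0 + u) \<noteq> x 0"
      using False by simp
    from solutions_difference_first_sign[OF assms(1-3) sol' sol ne, where r = r]
    obtain e N where N: "\<And>j. N \<le> j \<Longrightarrow> 0 < e * (x (r + j * h + u) $ a - x (r + j * h) $ a)"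
      by blast
    have "e \<noteq> 0"
      using N[of N] by auto
    \<comment> \<open>The factor \<open>e\<close> turns both directions of monotonicity into an
      increase. The sampling times are the times \<open>r + j * T * h\<close>, and
      \<open>j * T\<close> is at least \<open>j\<close>.\<close>
    have inc: "e * s j \<le> e * s (Suc j)" if "N \<le> j" for j
    proof -
      have "j * 1 \<le> j * T"
        using assms(4) by (rule mult_le_mono2)
      then have "N \<le> j * T"
        using that by (simp only: mult_1_right)
      then have "0 < e * (x (r + j * T * h + u) $ a - x (r + j * T * h) $ a)"
        by (rule N)
      moreover have "j * T * h = j * u"
        by (simp add: u_def mult_ac)
      ultimately have "0 < e * (x (r + j * u + u) $ a - x (r + j * u) $ a)"
        by (simp only:)
      then show ?thesis
        by (simp add: s_def algebra_simps)
    qed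
    have "incseq (\<lambda>j. e * s (j + N))"
      by (rule incseq_SucI) (simp add: inc)
    moreover have "Bseq (\<lambda>j. e * s (j + N))"
    proof -
      obtain B where "\<And>k. norm (x k) \<le> B"
        using bdd by (auto simp: bounded_iff)
      then have "\<bar>s j\<bar> \<le> B" for j
        using component_le_norm_cart order_trans unfolding s_def by blast
      then show ?thesis
        by (intro BseqI'[of _ "\<bar>e\<bar> * B"]) (simp add: abs_mult mult_left_mono)
    qed
    ultimately have "convergent (\<lambda>j. e * s (j + N))"
      by (blast intro: Bseq_monoseq_convergent incseq_imp_monoseq)
    then have "convergent (\<lambda>j. s (j + N))"
      using \<open>e \<noteq> 0\<close> by (simp add: convergent_mult_const_iff)
    then show "convergent (\<lambda>j. x (r + j * u) $ a)"
      unfolding s_def convergent_ignore_initial_segment[of "\<lambda>j. x (r + j * u) $ a"] .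
  qed
qed

text \<open>Each step of the system is a continuous map. This allows limit points of a sampled
  solution to be followed forward in time.\<close>

lemma solution_continuous_dependence:
  fixes C :: "nat \<Rightarrow> real ^ 'n::finite ^ 'n::finite"
  assumes "\<And>i y. isCont (f i) y" "is_solution C f \<xi>" "\<And>m. is_solution C f (y m)"
    and "(\<lambda>m. y m 0) \<longlonglongrightarrow> \<xi> 0"
  shows "(\<lambda>m. y m k) \<longlonglongrightarrow> \<xi> k"
proof (induction k)
  case (Suc k)
  have "(\<lambda>m. C k *v (\<chi> i. f i (y m k $ i))) \<longlonglongrightarrow> C k *v (\<chi> i. f i (\<xi> k $ i))"
    by (intro bounded_linear.tendsto[OF matrix_vector_mul_bounded_linear] tendsto_vec_lambda
        isCont_tendsto_compose[OF assms(1)] tendsto_vec_nth Suc.IH)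
  then show ?case
    using assms(2,3) by (simp add: is_solution_def)
qed (rule assms(4))

text \<open>If convergence failed, a subsequence would stay away from \<open>p\<close>; compactness
  gives it a further subsequence with a limit, which has to be \<open>p\<close>.\<close>

lemma compact_unique_limit_point_tendsto:
  fixes X :: "nat \<Rightarrow> 'a::metric_space"
  assumes "compact S" "\<And>j. X j \<in> S"
    and "\<And>s q. strict_mono s \<Longrightarrow> (X \<circ> s) \<longlonglongrightarrow> q \<Longrightarrow> q = p"
  shows "X \<longlonglongrightarrow> p"
proof (rule ccontr)
  assume "\<not> X \<longlonglongrightarrow> p"
  then obtain e where e: "0 < e" "\<not> (\<forall>\<^sub>F j in sequentially. dist (X j) p < e)"
    by (auto simp: tendsto_iff)
  have "infinite {j. e \<le> dist (X j) p}"
    using e(2) by (simp add: not_eventually not_less frequently_cofinite flip: cofinite_eq_sequentially)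
  then obtain s :: "nat \<Rightarrow> nat" where s: "strict_mono s" "\<And>j. e \<le> dist (X (s j)) p"
    using infinite_enumerate[of "{j. e \<le> dist (X j) p}"] by auto
  obtain q t where t: "strict_mono t" "((X \<circ> s) \<circ> t) \<longlonglongrightarrow> q"
    using assms(1,2) unfolding compact_def by (metis comp_apply)
  then have "q = p"
    using assms(3)[of "s \<circ> t" q] s(1) by (simp add: strict_mono_o comp_assoc)
  then have "\<forall>\<^sub>F j in sequentially. dist (X (s (t j))) p < e"
    using t(2) e(1) by (simp add: tendsto_iff)
  then show False
    using s(2) by (auto simp: eventually_sequentially not_less[symmetric])
qed

text \<open>There are finitely many residues, so one threshold \<open>N\<close> serves all of them,
  and every time from \<open>N * u\<close> on has a quotient of at least \<open>N\<close>.\<close>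

lemma tendsto_0_by_residues:
  fixes g :: "nat \<Rightarrow> 'a::real_normed_vector"
  assumes "0 < u" "\<And>r. r < u \<Longrightarrow> (\<lambda>j. g (r + j * u)) \<longlonglongrightarrow> 0"
  shows "g \<longlonglongrightarrow> 0"
proof (rule tendstoI)
  fix e :: real assume "0 < e"
  then have "\<forall>r\<in>{..<u}. \<forall>\<^sub>F j in sequentially. dist (g (r + j * u)) 0 < e"
    using tendstoD[OF assms(2)] by blast
  then have "\<forall>\<^sub>F j in sequentially. \<forall>r\<in>{..<u}. dist (g (r + j * u)) 0 < e"
    by (intro eventually_ball_finite) auto
  then obtain N where N: "\<And>j r. N \<le> j \<Longrightarrow> r < u \<Longrightarrow> dist (g (r + j * u)) 0 < e"
    by (auto simp: eventually_sequentially)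
  have "dist (g k) 0 < e" if "N * u \<le> k" for k
  proof -
    have "N \<le> k div u"
      using that assms(1) by (simp add: less_eq_div_iff_mult_less_eq)
    then show ?thesis
      using N[of "k div u" "k mod u"] assms(1) by simp
  qed
  then show "\<forall>\<^sub>F k in sequentially. dist (g k) 0 < e"
    by (auto simp: eventually_sequentially)
qed

text \<open>Limit points of the samples \<open>x (j * u)\<close> start solutions whose first
  coordinate at each time \<open>k\<close> is \<open>L k\<close>, so the sign statement leaves a
  single limit point \<open>p\<close>. The solution starting at \<open>p\<close> is periodic and
  attracts \<open>x\<close> along each residue class.\<close>

lemma bounded_solution_converges:
  fixes C :: "nat \<Rightarrow> real ^ 'n::{finite,linorder} ^ 'n::{finite,linorder}"
  assumes "ODTS C h" "\<And>i. strict_mono (f i)" "\<And>i y. isCont (f i) y"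
    and "T \<ge> 1" "periodic T C" and sol: "is_solution C f x" and bdd: "bounded (range x)"
  shows "converges_to_periodic_solution C f (h * T) x"
proof -
  define u where "u = h * T"
  have u: "0 < u"
    using assms(1,4) by (simp add: u_def ODTS_def)
  have C_per: "C (k + j * u) = C k" for k j
  proof -
    have "C (k + m * T) = C k" for m
    proof (induction m)
      case (Suc m)
      then show ?case
        using assms(5) by (metis add.assoc add.commute mult_Suc periodic_def)
    qed simp
    from this[of "j * h"] show ?thesis
      by (simp add: u_def mult.assoc)
  qed
  define a :: 'n where "a = Min UNIV"
  have a: "a \<le> i" for i
    by (simp add: a_def)
  have sol_shift: "is_solution C f (\<lambda>k. x (k + j * u))" for j
    by (rule is_solution_shift[OF sol C_per])
  have "convergent (\<lambda>j. x (k + j * u) $ a)" for k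
    using solution_first_coordinate_convergent[OF assms(1,2) a assms(4) sol _ bdd] C_per[of _ 1]
    by (simp add: u_def)
  then obtain L where L: "\<And>k. (\<lambda>j. x (k + j * u) $ a) \<longlonglongrightarrow> L k"
    unfolding convergent_def by metis
  define X where "X j = x (j * u)" for j
  have limit: "(\<lambda>j. x (k + s j * u)) \<longlonglongrightarrow> \<xi> k"
    if "(X \<circ> s) \<longlonglongrightarrow> p" "is_solution C f \<xi>" "\<xi> 0 = p" for s p \<xi> k
  proof -
    have "(\<lambda>j. x (0 + s j * u)) \<longlonglongrightarrow> \<xi> 0"
      using that by (simp add: X_def comp_def)
    then show ?thesis
      by (rule solution_continuous_dependence[OF assms(3) that(2) sol_shift])
  qed
  have first: "\<xi> k $ a = L k"
    if "strict_mono s" "(X \<circ> s) \<longlonglongrightarrow> p" "is_solution C f \<xi>" "\<xi> 0 = p" for s p \<xi> k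
  proof (rule LIMSEQ_unique)
    show "(\<lambda>j. x (k + s j * u) $ a) \<longlonglongrightarrow> \<xi> k $ a"
      by (rule tendsto_vec_nth[OF limit[OF that(2-4)]])
    show "(\<lambda>j. x (k + s j * u) $ a) \<longlonglongrightarrow> L k"
      using LIMSEQ_subseq_LIMSEQ[OF L that(1)] by (simp add: comp_def)
  qed
  have unique: "p = q"
    if "strict_mono s" "(X \<circ> s) \<longlonglongrightarrow> p" "strict_mono t" "(X \<circ> t) \<longlonglongrightarrow> q" for s t p q
  proof (rule ccontr)
    assume "p \<noteq> q"
    obtain \<xi> where \<xi>: "is_solution C f \<xi>" "\<xi> 0 = p"
      by (rule is_solution_exists)
    obtain \<eta> where \<eta>: "is_solution C f \<eta>" "\<eta> 0 = q"
      by (rule is_solution_exists)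
    have "\<xi> 0 \<noteq> \<eta> 0"
      using \<open>p \<noteq> q\<close> \<xi>(2) \<eta>(2) by simp
    from solutions_difference_first_sign[OF assms(1,2) a \<xi>(1) \<eta>(1) this, where r = 0]
    obtain e N where "\<And>j. N \<le> j \<Longrightarrow> 0 < e * (\<xi> (0 + j * h) $ a - \<eta> (0 + j * h) $ a)"
      by blast
    \<comment> \<open>Both first coordinates at time \<open>N * h\<close> equal
      \<open>L (N * h)\<close>, so their difference is zero.\<close>
    from this[of N] show False
      using first[OF that(1,2) \<xi>] first[OF that(3,4) \<eta>] by simp
  qed
  have X: "compact (closure (range x))" "\<And>j. X j \<in> closure (range x)"
    using bdd closure_subset[of "range x"] by (auto simp: X_def)
  obtain p s where s: "strict_mono s" "(X \<circ> s) \<longlonglongrightarrow> p"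
    using X unfolding compact_def by metis
  have "X \<longlonglongrightarrow> p"
    by (rule compact_unique_limit_point_tendsto[OF X]) (rule unique[OF _ _ s])
  then have p: "(X \<circ> id) \<longlonglongrightarrow> p"
    by simp
  obtain \<xi> where \<xi>: "is_solution C f \<xi>" "\<xi> 0 = p"
    by (rule is_solution_exists)
  have lim: "(\<lambda>j. x (k + j * u)) \<longlonglongrightarrow> \<xi> k" for k
    using limit[OF p \<xi>] by simp
  \<comment> \<open>The values \<open>x (u + j * u)\<close> are the samples of residue 0 one period
    later, so \<open>\<xi> u\<close> and \<open>\<xi> 0\<close> are limits of the same
    sequence.\<close>
  have "(\<lambda>j. x (0 + Suc j * u)) \<longlonglongrightarrow> \<xi> 0"
    using lim[of 0] by (rule LIMSEQ_Suc)
  then have "\<xi> u = \<xi> 0"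
    using lim[of u] by (intro LIMSEQ_unique[of "\<lambda>j. x (u + j * u)"]) simp_all
  then have \<xi>_per: "\<xi> (k + u) = \<xi> k" for k
    using is_solution_unique[OF is_solution_shift[OF \<xi>(1), of u] \<xi>(1)] C_per[of _ 1] by simp
  have "\<xi> (r + j * u) = \<xi> r" for r j
  proof (induction j)
    case (Suc j)
    then show ?case
      using \<xi>_per[of "r + j * u"] by (simp add: add_ac)
  qed simp
  then have "(\<lambda>j. x (r + j * u) - \<xi> (r + j * u)) \<longlonglongrightarrow> 0" for r
    using LIM_zero[OF lim] by simp
  then have "(\<lambda>k. x k - \<xi> k) \<longlonglongrightarrow> 0"
    by (rule tendsto_0_by_residues[OF u])
  moreover have "periodic (h * T) \<xi>"
    using \<xi>_per by (simp add: periodic_def u_def)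
  ultimately show ?thesis
    using \<xi>(1) unfolding converges_to_periodic_solution_def by blast
qed

text \<open>Positive derivatives make every \<open>f i\<close> strictly increasing and continuous,
  and a solution that stays in the compact set \<Omega> is bounded, so the convergence of bounded
  solutions applies.\<close>

theorem theorem3:
  fixes f :: "'n::{finite,linorder} \<Rightarrow> real \<Rightarrow> real"
    and C :: "nat \<Rightarrow> real ^ 'n::{finite,linorder} ^ 'n::{finite,linorder}"
    and \<Omega> :: "(real ^ 'n::{finite,linorder}) set"
    and T h :: nat
  assumes "\<And>i. f i C1_differentiable_on UNIV"
    and "\<And>i y. deriv (f i) y > 0"
    and "compact \<Omega>" and "convex \<Omega>"
    and "evolve_on C f \<Omega>"
    and "T \<ge> 1" and "periodic T C"
    and "ODTS C h"
  shows "\<forall>x. is_solution C f x \<and> x 0 \<in> \<Omega> \<longrightarrow>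
           converges_to_periodic_solution C f (h * T) x"
proof (intro allI impI)
  fix x assume x: "is_solution C f x \<and> x 0 \<in> \<Omega>"
  have deriv: "(f i has_real_derivative deriv (f i) y) (at y)" for i y
  proof -
    have "f i differentiable at y"
      using assms(1)[of i] by (simp add: C1_differentiable_on_eq)
    then show ?thesis
      using DERIV_deriv_iff_real_differentiable by blast
  qed
  have mono: "strict_mono (f i)" for i
  proof (rule strict_monoI)
    fix y z :: real assume "y < z"
    then show "f i y < f i z"
      by (rule DERIV_pos_imp_increasing) (blast intro: deriv assms(2))
  qed
  have "x k \<in> \<Omega>" for k
    using x assms(5) by (induction k) (auto simp: evolve_on_def)
  then have "bounded (range x)"
    using bounded_subset[OF compact_imp_bounded[OF assms(3)], of "range x"] by auto
  then show "converges_to_periodic_solution C f (h * T) x"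
    using assms(6-8) x mono DERIV_isCont[OF deriv] by (intro bounded_solution_converges) auto
qed

end
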